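(* Let $\mathbb{K}$ be a field of characteristic $0$, $\lambda\in\mathbb{K}$ nonzero, and let $(A,B,P)$ be a relative averaging algebra of weight $\lambda$. Then there is a bijection between the set of all equivalence classes of infinitesimal deformations of $(A,B,P)$ and the second cohomology group $H^2_{\mathrm{rAvg}_\lambda}(A,B,P)$.
   Context: Bimodules and operators (over a commutative ring). An associative $A$-bimodule is an associative algebra $B$ (product $xy=\nu(x,y)$) with bilinear actions $a\cdot x=l(a,x)$, $x\cdot a=r(x,a)\in B$ such that $(ab)\cdot x=a\cdot(b\cdot x)$, $(a\cdot x)\cdot b=a\cdot(x\cdot b)$, $(x\cdot a)\cdot b=x\cdot(ab)$, $(xy)\cdot a=x(y\cdot a)$, $(x\cdot a)y=x(a\cdot y)$, $(a\cdot x)y=a\cdot(xy)$ for $a,b\in A$, $x,y\in B$, where $ab=\mu(a,b)$. A relative averaging algebra of weight $\lambda$, $(A,B,P)=(A_\mu,B_\nu^{l,r},P)$, consists of an associative algebra $A$, an associative $A$-bimodule $B$ and a linear $P:B\to A$ with $P(x)P(y)=P(P(x)\cdot y)=P(x\cdot P(y))=\lambda P(xy)$. A morphism $(A,B,P)\to(A',B',P')$ is a pair of algebra homomorphisms $\varphi:A\to A'$, $\psi:B\to B'$ with $\psi(a\cdot x)=\varphi(a)\cdot'\psi(x)$, $\psi(x\cdot a)=\psi(x)\cdot'\varphi(a)$, $\varphi\circ P=P'\circ\psi$. Infinitesimal deformations. An infinitesimal deformation of $(A_\mu,B_\nu^{l,r},P)$ is a quintuple $\mu_t=\mu+t\mu_1$,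 $\nu_t=\nu+t\nu_1$, $l_t=l+tl_1$, $r_t=r+tr_1$, $P_t=P+tP_1$ (with $\mu_1:A\otimes A\to A$, $\nu_1:B\otimes B\to B$, $l_1:A\otimes B\to B$, $r_1:B\otimes A\to B$, $P_1:B\to A$ linear) such that $\big((A[[t]]/(t^2))_{\mu_t},(B[[t]]/(t^2))_{\nu_t}^{l_t,r_t},P_t\big)$ is a relative averaging algebra of weight $\lambda$ over $\mathbb{K}[[t]]/(t^2)$. Two infinitesimal deformations are equivalent if there are linear maps $\varphi_1:A\to A$, $\psi_1:B\to B$ such that $(\mathrm{id}_A+t\varphi_1,\mathrm{id}_B+t\psi_1)$ is a morphism of relative averaging algebras of weight $\lambda$ over $\mathbb{K}[[t]]/(t^2)$ from the first to the second. Trees. For $n\ge1$, $T_n$ is the set of planar rooted trees with $n+1$ leaves in which every internal vertex has at least two incoming edges; $T_0=\{|\}$. Leaves are labelled $0,\dots,n$ from left to right; $d_i$ deletes the $i$-th leaf (suppressing a vertex left with a single incoming edge). For $m,n\ge1$, $1\le i\le m$, $T\in T_{m+n-1}$: $R_0^{m;i,n}(T)\in T_m$ is obtained by deleting the leaves $i,\dots,i+n-2$, and $R_i^{m;i,n}(T)\in T_n$ by deleting all leaves except $i-1,\dots,i+n-1$. $T_1$ has one element. $T_2=\{T^{\dashv},T^{\vdash},T^{\perp}\}$: in $T^{\dashv}$ leaves 1,2 are joined at a vertex above the root vertex, in $T^{\vdash}$ leaves 0,1 are, and $T^{\perp}$ has one vertex with three leaves. Every $T\in T_n$ ($n\ge1$)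 is uniquely a grafting $T=T^{i_1-1}\vee\cdots\vee T^{i_k-1}$, $k\ge2$, $T^{i_j-1}\in T_{i_j-1}$ (roots joined, left to right, to a new root vertex), where $i_1+\dots+i_k=n+1$. The map $d_P$. With $D=A\oplus B$, $C^n(D,D)=\mathrm{Hom}(\mathbb{K}[T_n]\otimes D^{\otimes n},D)$, and for $f\in C^m$, $g\in C^n$: $[f,g]=\sum_{i=1}^m(-1)^{(i-1)(n-1)}f\circ_ig-(-1)^{(m-1)(n-1)}\sum_{i=1}^n(-1)^{(i-1)(m-1)}g\circ_if$, where $(f\circ_ig)(T;x_1,\dots,x_{m+n-1})=f(R_0^{m;i,n}(T);x_1,\dots,x_{i-1},g(R_i^{m;i,n}(T);x_i,\dots,x_{i+n-1}),x_{i+n},\dots,x_{m+n-1})$. Let $\pi_\lambda\in C^2(D,D)$: $\pi_\lambda(T^{\dashv};(a,x),(b,y))=(ab,x\cdot b)$, $\pi_\lambda(T^{\vdash};(a,x),(b,y))=(ab,a\cdot y)$, $\pi_\lambda(T^{\perp};(a,x),(b,y))=(ab,\lambda xy)$. $C^n(B,A)=\mathrm{Hom}(\mathbb{K}[T_n]\otimes B^{\otimes n},A)\subset C^n(D,D)$ for $n\ge1$ (extension by zero), $C^0(B,A)=0$. For $\gamma\in C^n(B,A)$, $d_P(\gamma)=d\gamma+\llbracket P,\gamma\rrbracket$, where $\llbracket P,\gamma\rrbracket=-[[\pi_\lambda,P],\gamma]$ and $(d\gamma)(T;x_1,\dots,x_{n+1})=(-1)^{n-1}\sum_{i=1}^n(-1)^{i-1}\gamma(d_iT;x_1,\dots,x_{i-1},\pi_\lambda(R_i^{n;i,2}(T);x_i,x_{i+1}),\dots,x_{n+1})$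 (for $x,y\in B$, $\pi_\lambda(S;x,y)$ is $\lambda xy$ if $S=T^\perp$ and $0$ otherwise). The cohomology. $\mathcal{A}^{k,l}$ is the direct sum of all $(k+l)$-fold tensor products of $A$'s and $B$'s with $A$ appearing $k$ times and $B$ appearing $l$ times. $C^0_{\mathrm{rAvg}_\lambda}=0$, $C^1_{\mathrm{rAvg}_\lambda}(A,B,P)=\mathrm{Hom}(A,A)\oplus\mathrm{Hom}(B,B)$, and for $n\ge2$, $C^n_{\mathrm{rAvg}_\lambda}(A,B,P)=\mathrm{Hom}(A^{\otimes n},A)\oplus\mathrm{Hom}(B^{\otimes n},B)\oplus\bigoplus_{k+l=n,\,k,l\ge1}\mathrm{Hom}(\mathcal{A}^{k,l},B)\oplus C^{n-1}(B,A)$, with elements $(f,g,h,\gamma)$ ($h=0,\gamma=0$ if $n=1$). The coboundary is $$\delta_{\mathrm{rAvg}_\lambda}(f,g,h,\gamma)=\big(\delta F,\ (-1)^{n-1}d_P(\gamma)+\theta_P(f,g,h)\big),$$ where $F=f+g+h:(A\oplus B)^{\otimes n}\to A\oplus B$ and $\delta F$ (decomposed again into its three components) is the Hochschild coboundary $(\delta F)(u_1,\dots,u_{n+1})=u_1F(u_2,\dots,u_{n+1})+\sum_{i=1}^n(-1)^iF(u_1,\dots,u_iu_{i+1},\dots,u_{n+1})+(-1)^{n+1}F(u_1,\dots,u_n)u_{n+1}$ for the associative product $(a,x)(b,y)=(ab,\,a\cdot y+x\cdot b+xy)$ on $A\oplus B$, and for $T=T^{i_1-1}\vee\cdots\vee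 T^{i_k-1}\in T_n$, $$\theta_P(f,g,h)(T;x_1,\dots,x_n)=(-1)^n\big\{f(P(x_1),\dots,P(x_n))-\lambda^{k-2}P\big((g+h)(c_1,\dots,c_n)\big)\big\},$$ $c_j=x_j$ if $j\in\{i_1,i_1+i_2,\dots,i_1+\cdots+i_{k-1}\}$ and $c_j=P(x_j)$ otherwise. $H^2_{\mathrm{rAvg}_\lambda}(A,B,P)$ is the second cohomology group of this complex. *)

theory Defs
  imports Complex_Main "HOL-Library.Product_Plus" "HOL-Library.Function_Algebras"
begin

section \<open>Relative averaging algebras over a commutative ring\<close>

definition bilin ::
  "('k::comm_ring_1 \<Rightarrow> 'a::ab_group_add \<Rightarrow> 'a) \<Rightarrow> ('k \<Rightarrow> 'b::ab_group_add \<Rightarrow> 'b)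
    \<Rightarrow> ('k \<Rightarrow> 'c::ab_group_add \<Rightarrow> 'c) \<Rightarrow> ('a \<Rightarrow> 'b \<Rightarrow> 'c) \<Rightarrow> bool" where
  "bilin s1 s2 s3 f \<longleftrightarrow>
     (\<forall>x. module_hom s2 s3 (\<lambda>y. f x y)) \<and> (\<forall>y. module_hom s1 s3 (\<lambda>x. f x y))"

text \<open>The data of a triple \<open>(A, B, P)\<close>: the two scalar multiplications, the products of
  \<open>A\<close> and \<open>B\<close>, the left and right actions of \<open>A\<close> on \<open>B\<close>, and the map \<open>P : B \<rightarrow> A\<close>.\<close>

record ('k, 'a, 'b) avg_data =
  scA :: "'k \<Rightarrow> 'a \<Rightarrow> 'a"
  scB :: "'k \<Rightarrow> 'b \<Rightarrow> 'b"
  mul :: "'a \<Rightarrow> 'a \<Rightarrow> 'a"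
  nul :: "'b \<Rightarrow> 'b \<Rightarrow> 'b"
  lac :: "'a \<Rightarrow> 'b \<Rightarrow> 'b"
  rac :: "'b \<Rightarrow> 'a \<Rightarrow> 'b"
  opr :: "'b \<Rightarrow> 'a"

definition assoc_algebra ::
  "('k::comm_ring_1 \<Rightarrow> 'a::ab_group_add \<Rightarrow> 'a) \<Rightarrow> ('a \<Rightarrow> 'a \<Rightarrow> 'a) \<Rightarrow> bool" where
  "assoc_algebra s m \<longleftrightarrow> module s \<and> bilin s s s m \<and> (\<forall>a b c. m (m a b) c = m a (m b c))"

definition assoc_bimodule ::
  "('k::comm_ring_1, 'a::ab_group_add, 'b::ab_group_add) avg_data \<Rightarrow> bool" where
  "assoc_bimodule S \<longleftrightarrow>
     assoc_algebra (scB S) (nul S) \<and>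
     bilin (scA S) (scB S) (scB S) (lac S) \<and> bilin (scB S) (scA S) (scB S) (rac S) \<and>
     (\<forall>a b x. lac S (mul S a b) x = lac S a (lac S b x)) \<and>
     (\<forall>a b x. rac S (lac S a x) b = lac S a (rac S x b)) \<and>
     (\<forall>a b x. rac S (rac S x a) b = rac S x (mul S a b)) \<and>
     (\<forall>a x y. rac S (nul S x y) a = nul S x (rac S y a)) \<and>
     (\<forall>a x y. nul S (rac S x a) y = nul S x (lac S a y)) \<and>
     (\<forall>a x y. nul S (lac S a x) y = lac S a (nul S x y))"

definition rel_avg_algebra ::
  "'k::comm_ring_1 \<Rightarrow> ('k, 'a::ab_group_add, 'b::ab_group_add) avg_data \<Rightarrow> bool" where
  "rel_avg_algebra lam S \<longleftrightarrow>
     assoc_algebra (scA S) (mul S) \<and> assoc_bimodule S \<and>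
     module_hom (scB S) (scA S) (opr S) \<and>
     (\<forall>x y. mul S (opr S x) (opr S y) = opr S (lac S (opr S x) y) \<and>
            mul S (opr S x) (opr S y) = opr S (rac S x (opr S y)) \<and>
            mul S (opr S x) (opr S y) = scA S lam (opr S (nul S x y)))"

definition rel_avg_morphism ::
  "('k::comm_ring_1, 'a::ab_group_add, 'b::ab_group_add) avg_data
    \<Rightarrow> ('k, 'c::ab_group_add, 'd::ab_group_add) avg_data
    \<Rightarrow> ('a \<Rightarrow> 'c) \<Rightarrow> ('b \<Rightarrow> 'd) \<Rightarrow> bool" where
  "rel_avg_morphism S S' \<phi> \<psi> \<longleftrightarrow>
     module_hom (scA S) (scA S') \<phi> \<and> (\<forall>a b. \<phi> (mul S a b) = mul S' (\<phi> a) (\<phi> b)) \<and>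
     module_hom (scB S) (scB S') \<psi> \<and> (\<forall>x y. \<psi> (nul S x y) = nul S' (\<psi> x) (\<psi> y)) \<and>
     (\<forall>a x. \<psi> (lac S a x) = lac S' (\<phi> a) (\<psi> x)) \<and>
     (\<forall>a x. \<psi> (rac S x a) = rac S' (\<psi> x) (\<phi> a)) \<and>
     (\<forall>x. \<phi> (opr S x) = opr S' (\<psi> x))"


section \<open>Infinitesimal deformations\<close>

text \<open>\<open>Trunc v w\<close> is the class of \<open>v + t w\<close> in \<open>V[[t]]/(t\<^sup>2)\<close>. For \<open>V\<close> a commutative ring
  this is again a commutative ring, and a module \<open>V\<close> over \<open>K\<close> yields a module
  over \<open>K[[t]]/(t\<^sup>2)\<close> with scalar multiplication \<open>trunc_scale\<close>.\<close>

datatype 'v trunc = Trunc (coeff0: 'v) (coeff1: 'v)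

instantiation trunc :: (ab_group_add) ab_group_add
begin
definition zero_trunc where "0 = Trunc 0 0"
definition plus_trunc where "u + v = Trunc (coeff0 u + coeff0 v) (coeff1 u + coeff1 v)"
definition minus_trunc where "u - v = Trunc (coeff0 u - coeff0 v) (coeff1 u - coeff1 v)"
definition uminus_trunc where "- u = Trunc (- coeff0 u) (- coeff1 u)"
instance
  by standard
    (simp_all add: zero_trunc_def plus_trunc_def minus_trunc_def uminus_trunc_def algebra_simps)
end

instantiation trunc :: (comm_ring_1) comm_ring_1
begin
definition one_trunc where "1 = Trunc 1 0"
definition times_trunc where
  "u * v = Trunc (coeff0 u * coeff0 v) (coeff0 u * coeff1 v + coeff1 u * coeff0 v)"
instance
  by standard
    (simp_all add: zero_trunc_def plus_trunc_def one_trunc_def times_trunc_def algebra_simps)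
end

definition trunc_scale ::
  "('k \<Rightarrow> 'v \<Rightarrow> 'v) \<Rightarrow> 'k trunc \<Rightarrow> 'v::ab_group_add trunc \<Rightarrow> 'v trunc" where
  "trunc_scale s c u =
     Trunc (s (coeff0 c) (coeff0 u)) (s (coeff0 c) (coeff1 u) + s (coeff1 c) (coeff0 u))"

lemma module_trunc_scale: "module s \<Longrightarrow> module (trunc_scale s)"
  by (rule module.intro)
    (simp_all add: trunc_scale_def plus_trunc_def times_trunc_def one_trunc_def
      module.scale_right_distrib module.scale_left_distrib module.scale_scale module.scale_one
      module.scale_zero_left algebra_simps)

text \<open>The \<open>K[[t]]/(t\<^sup>2)\<close>-linear, resp. -bilinear, extensions of \<open>f + t f1\<close>.\<close>

definition ext1 :: "('v \<Rightarrow> 'w) \<Rightarrow> ('v \<Rightarrow> 'w) \<Rightarrow> 'v trunc \<Rightarrow> 'w::ab_group_add trunc" where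
  "ext1 f f1 u = Trunc (f (coeff0 u)) (f (coeff1 u) + f1 (coeff0 u))"

definition ext2 ::
  "('u \<Rightarrow> 'v \<Rightarrow> 'w) \<Rightarrow> ('u \<Rightarrow> 'v \<Rightarrow> 'w) \<Rightarrow> 'u trunc \<Rightarrow> 'v trunc \<Rightarrow> 'w::ab_group_add trunc" where
  "ext2 f f1 u v = Trunc (f (coeff0 u) (coeff0 v))
     (f (coeff0 u) (coeff1 v) + f (coeff1 u) (coeff0 v) + f1 (coeff0 u) (coeff0 v))"

text \<open>The first-order terms \<open>(\<mu>1, \<nu>1, l1, r1, P1)\<close> of a deformation.\<close>

type_synonym ('a, 'b) quintuple =
  "('a \<Rightarrow> 'a \<Rightarrow> 'a) \<times> ('b \<Rightarrow> 'b \<Rightarrow> 'b) \<times> ('a \<Rightarrow> 'b \<Rightarrow> 'b) \<times> ('b \<Rightarrow> 'a \<Rightarrow> 'b) \<times> ('b \<Rightarrow> 'a)"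

definition deformed ::
  "('k, 'a::ab_group_add, 'b::ab_group_add) avg_data \<Rightarrow> ('a, 'b) quintuple
    \<Rightarrow> ('k trunc, 'a trunc, 'b trunc) avg_data" where
  "deformed S = (\<lambda>(\<mu>1, \<nu>1, l1, r1, P1).
     \<lparr> scA = trunc_scale (scA S), scB = trunc_scale (scB S),
       mul = ext2 (mul S) \<mu>1, nul = ext2 (nul S) \<nu>1,
       lac = ext2 (lac S) l1, rac = ext2 (rac S) r1, opr = ext1 (opr S) P1 \<rparr>)"

definition inf_deformations ::
  "'k::comm_ring_1 \<Rightarrow> ('k, 'a::ab_group_add, 'b::ab_group_add) avg_data
    \<Rightarrow> ('a, 'b) quintuple set" where
  "inf_deformations lam S = {(\<mu>1, \<nu>1, l1, r1, P1).
     bilin (scA S) (scA S) (scA S) \<mu>1 \<and> bilin (scB S) (scB S) (scB S) \<nu>1 \<and>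
     bilin (scA S) (scB S) (scB S) l1 \<and> bilin (scB S) (scA S) (scB S) r1 \<and>
     module_hom (scB S) (scA S) P1 \<and>
     rel_avg_algebra (Trunc lam 0) (deformed S (\<mu>1, \<nu>1, l1, r1, P1))}"

definition deformation_equiv ::
  "'k::comm_ring_1 \<Rightarrow> ('k, 'a::ab_group_add, 'b::ab_group_add) avg_data
    \<Rightarrow> (('a, 'b) quintuple \<times> ('a, 'b) quintuple) set" where
  "deformation_equiv lam S = {(Q, Q'). Q \<in> inf_deformations lam S \<and> Q' \<in> inf_deformations lam S \<and>
     (\<exists>\<phi>1 \<psi>1. module_hom (scA S) (scA S) \<phi>1 \<and> module_hom (scB S) (scB S) \<psi>1 \<and>
        rel_avg_morphism (deformed S Q) (deformed S Q') (ext1 id \<phi>1) (ext1 id \<psi>1))}"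


section \<open>Planar trees\<close>

datatype tree = Leaf | Node "tree list"

fun leaves :: "tree \<Rightarrow> nat" where
  "leaves Leaf = 1"
| "leaves (Node ts) = sum_list (map leaves ts)"

fun branching :: "tree \<Rightarrow> bool" where
  "branching Leaf = True"
| "branching (Node ts) \<longleftrightarrow> 2 \<le> length ts \<and> (\<forall>t \<in> set ts. branching t)"

definition trees :: "nat \<Rightarrow> tree set" where
  "trees n = {T. branching T \<and> leaves T = n + 1}"

text \<open>Grafting to a new root vertex, which is suppressed if it has a single incoming edge.\<close>

fun graft :: "tree list \<Rightarrow> tree" where
  "graft [t] = t"
| "graft ts = Node ts"

text \<open>\<open>del_leaf i T\<close> is \<open>d\<^sub>i T\<close>; leaves are numbered from \<open>0\<close>. The tree \<open>Leaf\<close>, from which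
  nothing can be deleted, is left unchanged.\<close>

fun del_leaf :: "nat \<Rightarrow> tree \<Rightarrow> tree" and del_leaf_list :: "nat \<Rightarrow> tree list \<Rightarrow> tree list" where
  "del_leaf i Leaf = Leaf"
| "del_leaf i (Node ts) = graft (del_leaf_list i ts)"
| "del_leaf_list i [] = []"
| "del_leaf_list i (t # ts) =
     (if i < leaves t then (if t = Leaf then ts else del_leaf i t # ts)
      else t # del_leaf_list (i - leaves t) ts)"

text \<open>Leaves are deleted from right to left, so that the remaining ones to be deleted keep
  their labels.\<close>

definition del_leaves :: "nat set \<Rightarrow> tree \<Rightarrow> tree" where
  "del_leaves X T = fold del_leaf (rev (sorted_list_of_set X)) T"

text \<open>\<open>R_outer m i n\<close> and \<open>R_inner m i n\<close> are the maps \<open>R\<^sub>0\<close> and \<open>R\<^sub>i\<close> with superscript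
  \<open>m;i,n\<close>, meaningful for \<open>m, n \<ge> 1\<close> and \<open>1 \<le> i \<le> m\<close> on trees with \<open>m + n\<close> leaves.\<close>

definition R_outer :: "nat \<Rightarrow> nat \<Rightarrow> nat \<Rightarrow> tree \<Rightarrow> tree" where
  "R_outer m i n T = del_leaves {i..i + n - 2} T"

definition R_inner :: "nat \<Rightarrow> nat \<Rightarrow> nat \<Rightarrow> tree \<Rightarrow> tree" where
  "R_inner m i n T = del_leaves ({0..m + n - 1} - {i - 1..i + n - 1}) T"

definition tree_dashv :: tree where "tree_dashv = Node [Leaf, Node [Leaf, Leaf]]"
definition tree_vdash :: tree where "tree_vdash = Node [Node [Leaf, Leaf], Leaf]"
definition tree_perp :: tree where "tree_perp = Node [Leaf, Leaf, Leaf]"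


section \<open>The bracket and the map \<open>d\<^sub>P\<close>\<close>

definition sign :: "nat \<Rightarrow> 'v::ab_group_add \<Rightarrow> 'v" where
  "sign k v = (if even k then v else - v)"

text \<open>Elements of \<open>Hom(K[T\<^sub>n] \<otimes> V\<^sup>\<otimes>\<^sup>n, W)\<close> are functions of a tree and of a list of arguments.
  The bracket of cochains of degrees \<open>m\<close> and \<open>n\<close> is meaningful on trees in \<open>trees (m + n - 1)\<close> and
  lists of length \<open>m + n - 1\<close>.\<close>

type_synonym ('v, 'w) tree_cochain = "tree \<Rightarrow> 'v list \<Rightarrow> 'w"

definition insertion ::
  "nat \<Rightarrow> nat \<Rightarrow> nat \<Rightarrow> ('d, 'd) tree_cochain \<Rightarrow> ('d, 'd) tree_cochain \<Rightarrow> ('d, 'd) tree_cochain" where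
  "insertion m n i f g T us =
     f (R_outer m i n T)
       (take (i - 1) us @ [g (R_inner m i n T) (take n (drop (i - 1) us))] @ drop (i - 1 + n) us)"

definition bracket ::
  "nat \<Rightarrow> nat \<Rightarrow> ('d::ab_group_add, 'd) tree_cochain \<Rightarrow> ('d, 'd) tree_cochain
    \<Rightarrow> ('d, 'd) tree_cochain" where
  "bracket m n f g T us =
     (\<Sum>i = 1..m. sign ((i - 1) * (n - 1)) (insertion m n i f g T us))
     - sign ((m - 1) * (n - 1))
         (\<Sum>i = 1..n. sign ((i - 1) * (m - 1)) (insertion n m i g f T us))"

definition pi_cochain ::
  "'k \<Rightarrow> ('k, 'a::zero, 'b::zero) avg_data \<Rightarrow> ('a \<times> 'b, 'a \<times> 'b) tree_cochain" where
  "pi_cochain lam S T us =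
     (let (a, x) = us ! 0; (b, y) = us ! 1 in
      if T = tree_dashv then (mul S a b, rac S x b)
      else if T = tree_vdash then (mul S a b, lac S a y)
      else if T = tree_perp then (mul S a b, scB S lam (nul S x y))
      else 0)"

text \<open>Extension by zero from \<open>B\<close> to \<open>A \<oplus> B\<close>; for multilinear maps of degree at least one.\<close>

definition zero_ext ::
  "('b, 'a) tree_cochain \<Rightarrow> ('a \<times> 'b, 'a \<times> 'b::zero) tree_cochain" where
  "zero_ext \<gamma> T us = (\<gamma> T (map snd us), 0)"

definition P_bracket ::
  "'k \<Rightarrow> ('k, 'a::ab_group_add, 'b::ab_group_add) avg_data \<Rightarrow> nat
    \<Rightarrow> ('b, 'a) tree_cochain \<Rightarrow> ('b, 'a) tree_cochain" where
  "P_bracket lam S n \<gamma> T xs =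
     - fst (bracket 2 n (bracket 2 1 (pi_cochain lam S) (zero_ext (\<lambda>_ ys. opr S (ys ! 0))))
              (zero_ext \<gamma>) T (map (Pair 0) xs))"

definition tree_d ::
  "'k \<Rightarrow> ('k, 'a::ab_group_add, 'b::ab_group_add) avg_data \<Rightarrow> nat
    \<Rightarrow> ('b, 'a) tree_cochain \<Rightarrow> ('b, 'a) tree_cochain" where
  "tree_d lam S n \<gamma> T xs =
     sign (n - 1) (\<Sum>i = 1..n. sign (i - 1)
       (\<gamma> (del_leaf i T)
          (take (i - 1) xs
           @ [snd (pi_cochain lam S (R_inner n i 2 T) [(0, xs ! (i - 1)), (0, xs ! i)])]
           @ drop (i + 1) xs)))"

definition d_P ::
  "'k \<Rightarrow> ('k, 'a::ab_group_add, 'b::ab_group_add) avg_data \<Rightarrow> nat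
    \<Rightarrow> ('b, 'a) tree_cochain \<Rightarrow> ('b, 'a) tree_cochain" where
  "d_P lam S n \<gamma> T xs =
     (if n = 0 then 0 else tree_d lam S n \<gamma> T xs + P_bracket lam S n \<gamma> T xs)"


section \<open>The cochain complex\<close>

text \<open>Multilinear maps are functions of argument lists that vanish on lists of the wrong length,
  and tree cochains also vanish on trees outside \<open>trees n\<close>; thus equality of functions is equality
  of multilinear maps.\<close>

definition multilin ::
  "('k::comm_ring_1 \<Rightarrow> 'v::ab_group_add \<Rightarrow> 'v) \<Rightarrow> ('k \<Rightarrow> 'w::ab_group_add \<Rightarrow> 'w) \<Rightarrow> nat
    \<Rightarrow> ('v list \<Rightarrow> 'w) set" where
  "multilin s s' n = {f.
     (\<forall>xs i. length xs = n \<longrightarrow> i < n \<longrightarrow> module_hom s s' (\<lambda>x. f (xs[i := x]))) \<and>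
     (\<forall>xs. length xs \<noteq> n \<longrightarrow> f xs = 0)}"

text \<open>A list of type \<open>('a + 'b) list\<close> encodes a pure tensor in a tensor product of copies of \<open>A\<close> and
  \<open>B\<close>, the pattern of \<open>Inl\<close> and \<open>Inr\<close> telling in which one. So an element of the direct sum
  of the \<open>Hom(\<A>\<^sup>k\<^sup>,\<^sup>l, B)\<close> with \<open>k + l = n\<close> and \<open>k, l \<ge> 1\<close> is a function on the mixed lists of
  length \<open>n\<close> which is linear in each entry.\<close>

definition mixed :: "('a + 'b) list \<Rightarrow> bool" where
  "mixed us \<longleftrightarrow> (\<exists>a. Inl a \<in> set us) \<and> (\<exists>x. Inr x \<in> set us)"

definition mixed_multilin ::
  "('k::comm_ring_1 \<Rightarrow> 'a::ab_group_add \<Rightarrow> 'a) \<Rightarrow> ('k \<Rightarrow> 'b::ab_group_add \<Rightarrow> 'b) \<Rightarrow> nat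
    \<Rightarrow> (('a + 'b) list \<Rightarrow> 'b) set" where
  "mixed_multilin s s' n = {h.
     (\<forall>us i. length us = n \<longrightarrow> i < n \<longrightarrow>
        module_hom s s' (\<lambda>a. h (us[i := Inl a])) \<and> module_hom s' s' (\<lambda>x. h (us[i := Inr x]))) \<and>
     (\<forall>us. \<not> (length us = n \<and> mixed us) \<longrightarrow> h us = 0)}"

definition tree_cochains ::
  "('k::comm_ring_1, 'a::ab_group_add, 'b::ab_group_add) avg_data \<Rightarrow> nat
    \<Rightarrow> ('b, 'a) tree_cochain set" where
  "tree_cochains S n =
     (if n = 0 then {0}
      else {\<gamma>. (\<forall>T \<in> trees n. \<gamma> T \<in> multilin (scB S) (scA S) n) \<and> (\<forall>T. T \<notin> trees n \<longrightarrow> \<gamma> T = 0)})"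

type_synonym ('a, 'b) cochain =
  "('a list \<Rightarrow> 'a) \<times> ('b list \<Rightarrow> 'b) \<times> (('a + 'b) list \<Rightarrow> 'b) \<times> ('b, 'a) tree_cochain"

definition cochains ::
  "('k::comm_ring_1, 'a::ab_group_add, 'b::ab_group_add) avg_data \<Rightarrow> nat
    \<Rightarrow> ('a, 'b) cochain set" where
  "cochains S n =
     (if n = 0 then {0}
      else multilin (scA S) (scA S) n \<times> multilin (scB S) (scB S) n
             \<times> mixed_multilin (scA S) (scB S) n \<times> tree_cochains S (n - 1))"

text \<open>The multilinear map \<open>F = f + g + h\<close> on \<open>A \<oplus> B\<close>. Each word \<open>w\<close> selects the component of
  every argument in \<open>A\<close> (\<open>True\<close>) or in \<open>B\<close> (\<open>False\<close>).\<close>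

definition total ::
  "('a list \<Rightarrow> 'a) \<Rightarrow> ('b list \<Rightarrow> 'b) \<Rightarrow> (('a + 'b) list \<Rightarrow> 'b) \<Rightarrow> ('a \<times> 'b) list
    \<Rightarrow> 'a \<times> 'b::comm_monoid_add" where
  "total f g h us =
     (f (map fst us),
      g (map snd us)
      + (\<Sum>w | length w = length us \<and> True \<in> set w \<and> False \<in> set w.
           h (map2 (\<lambda>b u. if b then Inl (fst u) else Inr (snd u)) w us)))"

fun incl :: "'a::zero + 'b::zero \<Rightarrow> 'a \<times> 'b" where
  "incl (Inl a) = (a, 0)"
| "incl (Inr x) = (0, x)"

definition semidirect_mult ::
  "('k, 'a, 'b::plus) avg_data \<Rightarrow> 'a \<times> 'b \<Rightarrow> 'a \<times> 'b \<Rightarrow> 'a \<times> 'b" where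
  "semidirect_mult S = (\<lambda>(a, x) (b, y). (mul S a b, lac S a y + rac S x b + nul S x y))"

definition hochschild ::
  "('d::ab_group_add \<Rightarrow> 'd \<Rightarrow> 'd) \<Rightarrow> nat \<Rightarrow> ('d list \<Rightarrow> 'd) \<Rightarrow> 'd list \<Rightarrow> 'd" where
  "hochschild m n F us =
     m (us ! 0) (F (tl us))
     + (\<Sum>i = 1..n. sign i (F (take (i - 1) us @ [m (us ! (i - 1)) (us ! i)] @ drop (i + 1) us)))
     + sign (n + 1) (m (F (take n us)) (us ! n))"

text \<open>For \<open>T = Node ts\<close> the number \<open>i\<^sub>j\<close> is the number of leaves of the \<open>j\<close>-th subtree, so
  \<open>marked ts\<close> is \<open>{i\<^sub>1, i\<^sub>1 + i\<^sub>2, \<dots>, i\<^sub>1 + \<dots> + i\<^sub>k\<^sub>-\<^sub>1}\<close>.\<close>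

definition marked :: "tree list \<Rightarrow> nat set" where
  "marked ts = {sum_list (map leaves (take q ts)) | q. 1 \<le> q \<and> q < length ts}"

text \<open>The second component of \<open>total f g h\<close> is \<open>g + h\<close>.\<close>

definition theta ::
  "'k::comm_ring_1 \<Rightarrow> ('k, 'a::ab_group_add, 'b::ab_group_add) avg_data \<Rightarrow> nat
    \<Rightarrow> ('a list \<Rightarrow> 'a) \<Rightarrow> ('b list \<Rightarrow> 'b) \<Rightarrow> (('a + 'b) list \<Rightarrow> 'b) \<Rightarrow> ('b, 'a) tree_cochain" where
  "theta lam S n f g h T xs =
     (case T of
        Leaf \<Rightarrow> 0
      | Node ts \<Rightarrow>
          sign n
            (f (map (opr S) xs)
             - scA S (lam ^ (length ts - 2))
                 (opr S (snd (total f g h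
                    (map (\<lambda>j. incl (if j \<in> marked ts then Inr (xs ! (j - 1))
                                     else Inl (opr S (xs ! (j - 1))))) [1..<n + 1]))))))"

text \<open>The coboundary in degree \<open>n\<close>, with values in degree \<open>n + 1\<close>.\<close>

definition coboundary ::
  "'k::comm_ring_1 \<Rightarrow> ('k, 'a::ab_group_add, 'b::ab_group_add) avg_data \<Rightarrow> nat
    \<Rightarrow> ('a, 'b) cochain \<Rightarrow> ('a, 'b) cochain" where
  "coboundary lam S n = (\<lambda>(f, g, h, \<gamma>).
     let dF = hochschild (semidirect_mult S) n (total f g h) in
     (\<lambda>as. if length as = n + 1 then fst (dF (map (\<lambda>a. (a, 0)) as)) else 0,
      \<lambda>xs. if length xs = n + 1 then snd (dF (map (Pair 0) xs)) else 0,
      \<lambda>us. if length us = n + 1 \<and> mixed us then snd (dF (map incl us)) else 0,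
      \<lambda>T xs. if T \<in> trees n \<and> length xs = n
              then sign (n - 1) (d_P lam S (n - 1) \<gamma> T xs) + theta lam S n f g h T xs else 0))"

definition cocycles ::
  "'k::comm_ring_1 \<Rightarrow> ('k, 'a::ab_group_add, 'b::ab_group_add) avg_data \<Rightarrow> nat
    \<Rightarrow> ('a, 'b) cochain set" where
  "cocycles lam S n = {c \<in> cochains S n. coboundary lam S n c = 0}"

definition coboundaries ::
  "'k::comm_ring_1 \<Rightarrow> ('k, 'a::ab_group_add, 'b::ab_group_add) avg_data \<Rightarrow> nat
    \<Rightarrow> ('a, 'b) cochain set" where
  "coboundaries lam S n = (if n = 0 then {0} else coboundary lam S (n - 1) ` cochains S (n - 1))"

definition cohomology ::
  "'k::comm_ring_1 \<Rightarrow> ('k, 'a::ab_group_add, 'b::ab_group_add) avg_data \<Rightarrow> nat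
    \<Rightarrow> ('a, 'b) cochain set set" where
  "cohomology lam S n =
     cocycles lam S n //
       {(c, c'). c \<in> cocycles lam S n \<and> c' \<in> cocycles lam S n \<and> c - c' \<in> coboundaries lam S n}"

end

theory Submission
  imports Defs
begin

text \<open>A deformation \<open>(\<mu>1, \<nu>1, l1, r1, P1)\<close> is sent to the 2-cochain \<open>(\<mu>1, \<nu>1, l1 + r1, P1)\<close>. The
  order-\<open>t\<close> parts of the eight associativity and bimodule axioms say that the Hochschild component
  of its coboundary vanishes, and those of the three averaging identities that the tree component
  vanishes, one identity for each element of \<open>T\<^sub>2\<close>. Likewise \<open>(id + t \<phi>, id + t \<psi>)\<close> is a morphism
  between two deformations iff their difference is the coboundary of \<open>(\<phi>, \<psi>)\<close>.\<close>

section \<open>Bilinear maps\<close>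

lemma bilin_iff:
  "bilin s1 s2 s3 f \<longleftrightarrow> module s1 \<and> module s2 \<and> module s3 \<and>
     (\<forall>x x' y. f (x + x') y = f x y + f x' y) \<and> (\<forall>x y y'. f x (y + y') = f x y + f x y') \<and>
     (\<forall>c x y. f (s1 c x) y = s3 c (f x y)) \<and> (\<forall>c x y. f x (s2 c y) = s3 c (f x y))"
  unfolding bilin_def module_hom_iff by blast

lemma bilin_simps:
  assumes "bilin s1 s2 s3 f"
  shows "f (x + x') y = f x y + f x' y" "f x (y + y') = f x y + f x y'"
    "f (s1 c x) y = s3 c (f x y)" "f x (s2 c y) = s3 c (f x y)"
    "f 0 y = 0" "f x 0 = 0"
  using assms
    module_hom.zero[of s1 s3 "\<lambda>x. f x y"] module_hom.zero[of s2 s3 "\<lambda>y. f x y"]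
  by (simp_all add: bilin_iff module_hom_iff)

text \<open>Together with \<open>bilin_ext2\<close> this settles all linearity axioms of
  \<open>deformed S Q\<close>: linearity of the first-order terms over the base ring already gives
  linearity over \<open>K[[t]]/(t^2)\<close>.\<close>

lemma module_hom_ext1:
  assumes "module_hom s s' f" "module_hom s s' f1"
  shows "module_hom (trunc_scale s) (trunc_scale s') (ext1 f f1)"
  using assms unfolding module_hom_iff
  by (auto simp: module_trunc_scale ext1_def plus_trunc_def trunc_scale_def
      module.scale_right_distrib algebra_simps)

lemma bilin_ext2:
  assumes "bilin s1 s2 s3 f" "bilin s1 s2 s3 f1"
  shows "bilin (trunc_scale s1) (trunc_scale s2) (trunc_scale s3) (ext2 f f1)"
  using assms unfolding bilin_iff
  by (auto simp: module_trunc_scale ext2_def plus_trunc_def trunc_scale_def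
      module.scale_right_distrib algebra_simps)

text \<open>Each associativity and bimodule axiom is of the form \<open>p (q a b) c = r a (s b c)\<close>.\<close>

lemma ext2_assoc_iff:
  assumes p: "bilin k1 k2 k3 p" and q: "bilin k4 k5 k6 q"
    and r: "bilin k7 k8 k9 r" and s: "bilin k10 k11 k12 s"
    and p1: "bilin k1 k2 k3 p1" and r1: "bilin k7 k8 k9 r1"
    and pqrs: "\<And>a b c. p (q a b) c = r a (s b c)"
  shows "(\<forall>a b c. ext2 p p1 (ext2 q q1 a b) c = ext2 r r1 a (ext2 s s1 b c)) \<longleftrightarrow>
         (\<forall>a b c. r a (s1 b c) - p1 (q a b) c + r1 a (s b c) - p (q1 a b) c = 0)"
    (is "?L \<longleftrightarrow> ?R")
proof
  assume ?L
  show ?R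
  proof (intro allI)
    fix a b c
    \<comment> \<open>Constant arguments suffice: every term with a t-part of an argument vanishes,
      and the t-coefficient keeps just the terms containing a first-order map.\<close>
    have "ext2 p p1 (ext2 q q1 (Trunc a 0) (Trunc b 0)) (Trunc c 0) =
          ext2 r r1 (Trunc a 0) (ext2 s s1 (Trunc b 0) (Trunc c 0))"
      using \<open>?L\<close> by blast
    then show "r a (s1 b c) - p1 (q a b) c + r1 a (s b c) - p (q1 a b) c = 0"
      by (simp add: ext2_def bilin_simps[OF p] bilin_simps[OF q] bilin_simps[OF r] bilin_simps[OF s]
          algebra_simps)
  qed
next
  assume R: ?R
  \<comment> \<open>The t-coefficient at general arguments is this equation at their constant
    coefficients plus three instances of \<open>pqrs\<close>, one for each argument that supplies
    its t-part.\<close>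
  have "p (q1 a b) c + p1 (q a b) c = r a (s1 b c) + r1 a (s b c)" for a b c
    using R[rule_format, of a b c] by (simp add: algebra_simps)
  then show ?L
    by (simp add: ext2_def bilin_simps[OF p] bilin_simps[OF r] pqrs algebra_simps)
qed

section \<open>First-order form of the deformation equations\<close>

text \<open>Candidates for deformations before any equation is imposed; \<open>cochains_2\<close>
  matches them with the 2-cochains.\<close>

definition linear_quintuples ::
  "('k::comm_ring_1, 'a::ab_group_add, 'b::ab_group_add) avg_data \<Rightarrow> ('a, 'b) quintuple set" where
  "linear_quintuples S = {(\<mu>1, \<nu>1, l1, r1, P1).
     bilin (scA S) (scA S) (scA S) \<mu>1 \<and> bilin (scB S) (scB S) (scB S) \<nu>1 \<and>
     bilin (scA S) (scB S) (scB S) l1 \<and> bilin (scB S) (scA S) (scB S) r1 \<and>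
     module_hom (scB S) (scA S) P1}"

text \<open>The order-t part of the deformed semidirect product on the direct sum of A and B, that
  is, \<open>F = f + g + h\<close> for the associated 2-cochain.\<close>

definition mult1 :: "('a, 'b) quintuple \<Rightarrow> 'a \<times> 'b \<Rightarrow> 'a \<times> 'b \<Rightarrow> 'a \<times> 'b::plus" where
  "mult1 = (\<lambda>(\<mu>1, \<nu>1, l1, r1, P1) (a, x) (b, y). (\<mu>1 a b, l1 a y + r1 x b + \<nu>1 x y))"

text \<open>The order-t axioms, arranged with the signs of the Hochschild coboundary
  \<open>u F(v,w) - F(uv,w) + F(u,vw) - F(u,v) w\<close>. The eight lines are the eight ways to
  choose each of three arguments in A or in B.\<close>

definition bimodule_equations ::
  "('k, 'a::ab_group_add, 'b::ab_group_add) avg_data \<Rightarrow> ('a, 'b) quintuple \<Rightarrow> bool" where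
  "bimodule_equations S = (\<lambda>(\<mu>1, \<nu>1, l1, r1, P1).
     (\<forall>a b c. mul S a (\<mu>1 b c) - \<mu>1 (mul S a b) c + \<mu>1 a (mul S b c) - mul S (\<mu>1 a b) c = 0) \<and>
     (\<forall>x y z. nul S x (\<nu>1 y z) - \<nu>1 (nul S x y) z + \<nu>1 x (nul S y z) - nul S (\<nu>1 x y) z = 0) \<and>
     (\<forall>a b x. lac S a (l1 b x) - l1 (mul S a b) x + l1 a (lac S b x) - lac S (\<mu>1 a b) x = 0) \<and>
     (\<forall>a x b. lac S a (r1 x b) - r1 (lac S a x) b + l1 a (rac S x b) - rac S (l1 a x) b = 0) \<and>
     (\<forall>x a b. rac S x (\<mu>1 a b) - r1 (rac S x a) b + r1 x (mul S a b) - rac S (r1 x a) b = 0) \<and>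
     (\<forall>x y a. nul S x (r1 y a) - r1 (nul S x y) a + \<nu>1 x (rac S y a) - rac S (\<nu>1 x y) a = 0) \<and>
     (\<forall>x a y. nul S x (l1 a y) - \<nu>1 (rac S x a) y + \<nu>1 x (lac S a y) - nul S (r1 x a) y = 0) \<and>
     (\<forall>a x y. lac S a (\<nu>1 x y) - \<nu>1 (lac S a x) y + l1 a (nul S x y) - nul S (l1 a x) y = 0))"

text \<open>\<open>M x y\<close> is the t-coefficient of the product of the deformed
  \<open>P x\<close> and \<open>P y\<close>. The three equations correspond, in this order, to
  \<open>tree_vdash\<close>, \<open>tree_dashv\<close> and \<open>tree_perp\<close>.\<close>

definition averaging_equations ::
  "'k \<Rightarrow> ('k, 'a::ab_group_add, 'b::ab_group_add) avg_data \<Rightarrow> ('a, 'b) quintuple \<Rightarrow> bool" where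
  "averaging_equations lam S = (\<lambda>(\<mu>1, \<nu>1, l1, r1, P1).
     let P = opr S; M = (\<lambda>x y. mul S (P1 x) (P y) + mul S (P x) (P1 y) + \<mu>1 (P x) (P y)) in
     (\<forall>x y. M x y = P1 (lac S (P x) y) + P (lac S (P1 x) y) + P (l1 (P x) y)) \<and>
     (\<forall>x y. M x y = P1 (rac S x (P y)) + P (rac S x (P1 y)) + P (r1 x (P y))) \<and>
     (\<forall>x y. M x y = scA S lam (P1 (nul S x y)) + scA S lam (P (\<nu>1 x y))))"

locale rel_avg =
  fixes lam :: "'k::comm_ring_1"
    and S :: "('k, 'a::ab_group_add, 'b::ab_group_add) avg_data"
  assumes rel_avg: "rel_avg_algebra lam S"
begin

lemma bilin_structure:
  "bilin (scA S) (scA S) (scA S) (mul S)" "bilin (scB S) (scB S) (scB S) (nul S)"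
  "bilin (scA S) (scB S) (scB S) (lac S)" "bilin (scB S) (scA S) (scB S) (rac S)"
  and hom_opr: "module_hom (scB S) (scA S) (opr S)"
  and module_A: "module (scA S)" and module_B: "module (scB S)"
  using rel_avg unfolding rel_avg_algebra_def assoc_bimodule_def assoc_algebra_def by blast+

lemma axioms_S:
  "mul S (mul S a b) c = mul S a (mul S b c)" "nul S (nul S x y) z = nul S x (nul S y z)"
  "lac S (mul S a b) x = lac S a (lac S b x)" "rac S (lac S a x) b = lac S a (rac S x b)"
  "rac S (rac S x a) b = rac S x (mul S a b)" "rac S (nul S x y) a = nul S x (rac S y a)"
  "nul S (rac S x a) y = nul S x (lac S a y)" "nul S (lac S a x) y = lac S a (nul S x y)"
  using rel_avg by (simp_all only: rel_avg_algebra_def assoc_bimodule_def assoc_algebra_def)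

lemma avg_S:
  "mul S (opr S x) (opr S y) = opr S (lac S (opr S x) y)"
  "mul S (opr S x) (opr S y) = opr S (rac S x (opr S y))"
  "mul S (opr S x) (opr S y) = scA S lam (opr S (nul S x y))"
  using rel_avg unfolding rel_avg_algebra_def by blast+

lemmas simps_S =
  bilin_simps[OF bilin_structure(1)] bilin_simps[OF bilin_structure(2)]
  bilin_simps[OF bilin_structure(3)] bilin_simps[OF bilin_structure(4)]
  module_hom.add[OF hom_opr] module_hom.zero[OF hom_opr] module_hom.scale[OF hom_opr]
  module.scale_zero_right[OF module_A] module.scale_zero_right[OF module_B]
  module.scale_zero_left[OF module_A] module.scale_one[OF module_A]
  module.scale_right_distrib[OF module_A]

lemma ext_averaging:
  assumes p1: "module_hom (scB S) (scA S) P1" and l1: "bilin (scA S) (scB S) (scB S) l1"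
    and \<mu>1: "bilin (scA S) (scA S) (scA S) \<mu>1"
    and r1: "bilin (scB S) (scA S) (scB S) r1" and \<nu>1: "bilin (scB S) (scB S) (scB S) \<nu>1"
  shows "(\<forall>x y. let P = ext1 (opr S) P1 in
       ext2 (mul S) \<mu>1 (P x) (P y) = P (ext2 (lac S) l1 (P x) y) \<and>
       ext2 (mul S) \<mu>1 (P x) (P y) = P (ext2 (rac S) r1 x (P y)) \<and>
       ext2 (mul S) \<mu>1 (P x) (P y) = trunc_scale (scA S) (Trunc lam 0) (P (ext2 (nul S) \<nu>1 x y)))
     \<longleftrightarrow> averaging_equations lam S (\<mu>1, \<nu>1, l1, r1, P1)" (is "?L \<longleftrightarrow> ?R")
proof
  assume L: ?L
  have "mul S (P1 x) (opr S y) + mul S (opr S x) (P1 y) + \<mu>1 (opr S x) (opr S y)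
        = P1 (lac S (opr S x) y) + opr S (lac S (P1 x) y) + opr S (l1 (opr S x) y)"
    "mul S (P1 x) (opr S y) + mul S (opr S x) (P1 y) + \<mu>1 (opr S x) (opr S y)
        = P1 (rac S x (opr S y)) + opr S (rac S x (P1 y)) + opr S (r1 x (opr S y))"
    "mul S (P1 x) (opr S y) + mul S (opr S x) (P1 y) + \<mu>1 (opr S x) (opr S y)
        = scA S lam (P1 (nul S x y)) + scA S lam (opr S (\<nu>1 x y))" for x y
    using L[rule_format, of "Trunc x 0" "Trunc y 0"]
    by (auto simp: Let_def ext1_def ext2_def trunc_scale_def simps_S module_hom.zero[OF p1]
        algebra_simps)
  then show ?R by (simp add: averaging_equations_def Let_def)
next
  assume ?R
  then have
    "mul S (P1 x) (opr S y) + mul S (opr S x) (P1 y) + \<mu>1 (opr S x) (opr S y)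
        = P1 (lac S (opr S x) y) + opr S (lac S (P1 x) y) + opr S (l1 (opr S x) y)"
    "mul S (P1 x) (opr S y) + mul S (opr S x) (P1 y) + \<mu>1 (opr S x) (opr S y)
        = P1 (rac S x (opr S y)) + opr S (rac S x (P1 y)) + opr S (r1 x (opr S y))"
    "mul S (P1 x) (opr S y) + mul S (opr S x) (P1 y) + \<mu>1 (opr S x) (opr S y)
        = scA S lam (P1 (nul S x y)) + scA S lam (opr S (\<nu>1 x y))" for x y
    unfolding averaging_equations_def Let_def prod.case by blast+
  note eqs = this
  show ?L
    unfolding Let_def
  proof (intro allI conjI)
    fix x y :: "'b trunc"
    obtain x0 x1 y0 y1 where [simp]: "x = Trunc x0 x1" "y = Trunc y0 y1"
      by (metis trunc.collapse)
    \<comment> \<open>The constant coefficient is the undeformed identity at \<open>x0 y0\<close>.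
      The t-coefficient is the sum of that identity at \<open>x0 y1\<close> and \<open>x1 y0\<close>
      and of the first-order equation at \<open>x0 y0\<close>.\<close>
    show "ext2 (mul S) \<mu>1 (ext1 (opr S) P1 x) (ext1 (opr S) P1 y) =
      ext1 (opr S) P1 (ext2 (lac S) l1 (ext1 (opr S) P1 x) y)"
      using eqs(1)[of x0 y0] avg_S(1)[of x0 y0] avg_S(1)[of x0 y1] avg_S(1)[of x1 y0]
      by (simp add: ext1_def ext2_def simps_S algebra_simps)
    show "ext2 (mul S) \<mu>1 (ext1 (opr S) P1 x) (ext1 (opr S) P1 y) =
      ext1 (opr S) P1 (ext2 (rac S) r1 x (ext1 (opr S) P1 y))"
      using eqs(2)[of x0 y0] avg_S(2)[of x0 y0] avg_S(2)[of x0 y1] avg_S(2)[of x1 y0]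
      by (simp add: ext1_def ext2_def simps_S algebra_simps)
    show "ext2 (mul S) \<mu>1 (ext1 (opr S) P1 x) (ext1 (opr S) P1 y) =
      trunc_scale (scA S) (Trunc lam 0) (ext1 (opr S) P1 (ext2 (nul S) \<nu>1 x y))"
      using eqs(3)[of x0 y0] avg_S(3)[of x0 y0] avg_S(3)[of x0 y1] avg_S(3)[of x1 y0]
      by (simp add: ext1_def ext2_def trunc_scale_def simps_S algebra_simps)
  qed
qed

text \<open>Linearity is automatic and the constant coefficients of all axioms hold in
  \<open>S\<close>, so only the t-coefficients impose conditions.\<close>

lemma inf_deformations_iff:
  "Q \<in> inf_deformations lam S \<longleftrightarrow>
     Q \<in> linear_quintuples S \<and> bimodule_equations S Q \<and> averaging_equations lam S Q"
proof -
  obtain \<mu>1 \<nu>1 l1 r1 P1 where Q: "Q = (\<mu>1, \<nu>1, l1, r1, P1)" by (cases Q) auto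
  have "rel_avg_algebra (Trunc lam 0) (deformed S Q) \<longleftrightarrow>
      bimodule_equations S Q \<and> averaging_equations lam S Q" if lin: "Q \<in> linear_quintuples S"
  proof -
    from lin have \<mu>1: "bilin (scA S) (scA S) (scA S) \<mu>1" and \<nu>1: "bilin (scB S) (scB S) (scB S) \<nu>1"
      and l1: "bilin (scA S) (scB S) (scB S) l1" and r1: "bilin (scB S) (scA S) (scB S) r1"
      and P1: "module_hom (scB S) (scA S) P1"
      by (auto simp: linear_quintuples_def Q)
    note m = bilin_structure(1) and n = bilin_structure(2) and l = bilin_structure(3)
      and r = bilin_structure(4)
    \<comment> \<open>Each list gives the operations in the roles p, q, r, s, then the first-order
      terms of the outer operations p and r.\<close>
    note assoc =
      ext2_assoc_iff[OF m m m m \<mu>1 \<mu>1 axioms_S(1)]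
      ext2_assoc_iff[OF n n n n \<nu>1 \<nu>1 axioms_S(2)]
      ext2_assoc_iff[OF l m l l l1 l1 axioms_S(3)]
      ext2_assoc_iff[OF r l l r r1 l1 axioms_S(4)]
      ext2_assoc_iff[OF r r r m r1 r1 axioms_S(5)]
      ext2_assoc_iff[OF r n n r r1 \<nu>1 axioms_S(6)]
      ext2_assoc_iff[OF n r n l \<nu>1 \<nu>1 axioms_S(7)]
      ext2_assoc_iff[OF n l l n \<nu>1 l1 axioms_S(8)]
    have *: "assoc_algebra (scA (deformed S Q)) (mul (deformed S Q)) \<and> assoc_bimodule (deformed S Q)
        \<longleftrightarrow> bimodule_equations S Q"
      unfolding bimodule_equations_def Q prod.case assoc[symmetric]
      by (simp add: assoc_algebra_def assoc_bimodule_def deformed_def module_trunc_scale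
          module_A module_B bilin_ext2[OF m \<mu>1] bilin_ext2[OF n \<nu>1] bilin_ext2[OF l l1]
          bilin_ext2[OF r r1]) (intro iffI conjI allI; elim conjE; simp only:)
    show ?thesis
      unfolding *[symmetric] ext_averaging[OF P1 l1 \<mu>1 r1 \<nu>1, folded Q, symmetric]
      by (auto simp add: rel_avg_algebra_def deformed_def Q Let_def module_hom_ext1[OF hom_opr P1])
  qed
  then show ?thesis
    by (auto simp: inf_deformations_def linear_quintuples_def Q)
qed

end


section \<open>Trees with at most three leaves\<close>

lemma leaves_pos: "branching T \<Longrightarrow> 0 < leaves T"
proof (induction T)
  case (Node ts)
  then show ?case by (cases ts) auto
qed simp

text \<open>Each subtree carries at least one leaf. This bounds the arity of the root and makes the
  enumeration of small trees finite.\<close>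

lemma length_le_leaves: "\<forall>t \<in> set ts. branching t \<Longrightarrow> length ts \<le> sum_list (map leaves ts)"
proof (induction ts)
  case (Cons t ts)
  then show ?case using leaves_pos[of t] by simp
qed simp

lemma leaves_eq_1: "branching T \<Longrightarrow> leaves T = Suc 0 \<Longrightarrow> T = Leaf"
proof (cases T)
  case (Node ts)
  assume "branching T" "leaves T = Suc 0"
  with Node length_le_leaves[of ts] show ?thesis by auto
qed simp

lemma trees_1: "trees 1 = {Node [Leaf, Leaf]}"
proof -
  have "T = Node [Leaf, Leaf]" if T: "branching T" "leaves T = 2" for T
  proof (cases T)
    case (Node ts)
    with T length_le_leaves[of ts] have "length ts = 2" by simp
    then obtain s t where ts: "ts = [s, t]"
      by (auto simp: numeral_2_eq_2 length_Suc_conv)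
    with T Node have st: "branching s" "branching t" "leaves s + leaves t = 2" by auto
    with leaves_pos[of s] leaves_pos[of t] have "leaves s = Suc 0" "leaves t = Suc 0" by linarith+
    with st ts Node show ?thesis by (simp add: leaves_eq_1)
  qed (use T in simp)
  then show ?thesis by (auto simp: trees_def)
qed

text \<open>The root has arity two, with leaf counts 1+2 or 2+1, or arity three with three leaves as
  children.\<close>

lemma trees_2: "trees 2 = {tree_dashv, tree_vdash, tree_perp}"
proof -
  have "T \<in> {tree_dashv, tree_vdash, tree_perp}" if T: "branching T" "leaves T = 3" for T
  proof (cases T)
    case (Node ts)
    with T length_le_leaves[of ts] consider "length ts = 2" | "length ts = 3" by fastforce
    then show ?thesis
    proof cases
      case 1
      then obtain s t where ts: "ts = [s, t]"
        by (auto simp: numeral_2_eq_2 length_Suc_conv)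
      with T Node have st: "branching s" "branching t" "leaves s + leaves t = 3" by auto
      with leaves_pos[of s] leaves_pos[of t]
      consider "leaves s = Suc 0" "leaves t = 2" | "leaves s = 2" "leaves t = Suc 0" by linarith
      then consider "s = Leaf" "t \<in> trees 1" | "s \<in> trees 1" "t = Leaf"
        using st by cases (auto simp: trees_def leaves_eq_1)
      then show ?thesis using ts Node
        unfolding trees_1 by cases (simp_all add: tree_dashv_def tree_vdash_def)
    next
      case 2
      then obtain s t u where ts: "ts = [s, t, u]"
        by (auto simp: numeral_3_eq_3 length_Suc_conv)
      with T Node have stu: "branching s" "branching t" "branching u"
        "leaves s + leaves t + leaves u = 3" by auto
      with leaves_pos[of s] leaves_pos[of t] leaves_pos[of u]
      have "leaves s = Suc 0" "leaves t = Suc 0" "leaves u = Suc 0" by linarith+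
      with stu ts Node show ?thesis by (simp add: leaves_eq_1 tree_perp_def)
    qed
  qed (use T in simp)
  then show ?thesis by (auto simp: trees_def tree_dashv_def tree_vdash_def tree_perp_def)
qed

section \<open>Leaf deletion and the bracket on trees with three leaves\<close>

text \<open>For \<open>n = 1\<close> the interval \<open>{i..i + n - 2}\<close> is empty, so nothing
  is deleted; for \<open>n = 2\<close> it is the single leaf \<open>i\<close>.\<close>

lemma R_outer_simps: "R_outer 2 (Suc 0) (Suc 0) T = T" "R_outer 2 2 (Suc 0) T = T"
  "R_outer (Suc 0) (Suc 0) 2 T = del_leaf 1 T"
  by (simp_all add: R_outer_def del_leaves_def)

lemma R_inner_simps: "R_inner 2 (Suc 0) (Suc 0) T = del_leaf 2 T"
  "R_inner 2 2 (Suc 0) T = del_leaf 0 T"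
  "R_inner (Suc 0) (Suc 0) 2 T = T"
proof -
  have "{0..2} - {0..1} = {2::nat}" "{0..2} - {1..2} = {0::nat}" by auto
  then show "R_inner 2 (Suc 0) (Suc 0) T = del_leaf 2 T"
    "R_inner 2 2 (Suc 0) T = del_leaf 0 T" "R_inner (Suc 0) (Suc 0) 2 T = T"
    by (simp_all add: R_inner_def del_leaves_def)
qed

text \<open>There is only one tree with two leaves, so degree-one cochains are always evaluated on
  it.\<close>

lemma del_leaf_trees_2:
  assumes "T \<in> trees 2"
  shows "del_leaf 0 T = Node [Leaf, Leaf]" "del_leaf (Suc 0) T = Node [Leaf, Leaf]"
    "del_leaf 2 T = Node [Leaf, Leaf]"
  using assms by (auto simp: trees_2 tree_dashv_def tree_vdash_def tree_perp_def)

lemma atLeastAtMost_1_2: "{Suc 0..2} = {Suc 0, 2}"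
  by auto

text \<open>All sign exponents vanish because one degree is one. Applied twice, this expands the
  double bracket in \<open>P_bracket\<close>.\<close>

lemma bracket_2_1:
  assumes "T \<in> trees 2"
  shows "bracket 2 (Suc 0) f g T [u, v] = f T [g (Node [Leaf, Leaf]) [u], v]
     + f T [u, g (Node [Leaf, Leaf]) [v]] - g (Node [Leaf, Leaf]) [f T [u, v]]"
  by (simp add: bracket_def insertion_def sign_def R_outer_simps R_inner_simps
      del_leaf_trees_2[OF assms] atLeastAtMost_1_2)

section \<open>Deformations as cochains\<close>

text \<open>The zero defaults are those demanded by \<open>multilin\<close>,
  \<open>mixed_multilin\<close> and \<open>tree_cochains\<close>. Both actions are packed into one
  map on mixed lists, and the operator sits on the unique tree of \<open>trees 1\<close>.\<close>

definition to_cochain :: "('a, 'b) quintuple \<Rightarrow> ('a::zero, 'b::zero) cochain" where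
  "to_cochain = (\<lambda>(\<mu>1, \<nu>1, l1, r1, P1).
     (\<lambda>as. if length as = 2 then \<mu>1 (as ! 0) (as ! 1) else 0,
      \<lambda>xs. if length xs = 2 then \<nu>1 (xs ! 0) (xs ! 1) else 0,
      \<lambda>us. case us of [Inl a, Inr x] \<Rightarrow> l1 a x | [Inr x, Inl a] \<Rightarrow> r1 x a | _ \<Rightarrow> 0,
      \<lambda>T xs. if T = Node [Leaf, Leaf] \<and> length xs = 1 then P1 (xs ! 0) else 0))"

lemma total_pair:
  "total f g h [u, v] =
     (f [fst u, fst v],
      g [snd u, snd v] + (h [Inl (fst u), Inr (snd v)] + h [Inr (snd u), Inl (fst v)]))"
proof -
  \<comment> \<open>The two words stand for the left and the right action.\<close>
  have "{w. length w = Suc (Suc 0) \<and> True \<in> set w \<and> False \<in> set w} = {[True, False], [False, True]}"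
    by (auto simp: length_Suc_conv)
  then show ?thesis by (simp add: total_def)
qed

lemma total_single: "total f g h [u] = (f [fst u], g [snd u])"
proof -
  have "{w. length w = Suc 0 \<and> True \<in> set w \<and> False \<in> set w} = {}"
    by (auto simp: length_Suc_conv)
  then show ?thesis by (simp add: total_def del: Collect_empty_eq)
qed

lemma total_to_cochain:
  "to_cochain Q = (f, g, h, \<gamma>) \<Longrightarrow> total f g h [u, v] = mult1 Q u v"
  by (cases Q) (auto simp: to_cochain_def mult1_def total_pair add_ac split: prod.splits)

lemma hochschild_1: "hochschild m 1 F [u, v] = m u (F [v]) - F [m u v] + m (F [u]) v"
  by (simp add: hochschild_def sign_def)

lemma hochschild_2:
  "hochschild m 2 F [u, v, w] = m u (F [v, w]) - F [m u v, w] + F [u, m v w] - m (F [u, v]) w"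
  by (simp add: hochschild_def sign_def atLeastAtMost_1_2)

text \<open>Left inverse of \<open>to_cochain\<close> on all quintuples, and right inverse on
  \<open>cochains S 2\<close>.\<close>

definition of_cochain :: "('a, 'b) cochain \<Rightarrow> ('a, 'b) quintuple" where
  "of_cochain = (\<lambda>(f, g, h, \<gamma>).
     (\<lambda>a b. f [a, b], \<lambda>x y. g [x, y], \<lambda>a x. h [Inl a, Inr x], \<lambda>x a. h [Inr x, Inl a],
      \<lambda>x. \<gamma> (Node [Leaf, Leaf]) [x]))"

lemma of_to_cochain: "of_cochain (to_cochain Q) = Q"
  by (cases Q) (simp add: of_cochain_def to_cochain_def)

lemma to_cochain_diff:
  fixes Q Q' :: "('a::ab_group_add, 'b::ab_group_add) quintuple"
  shows "to_cochain Q - to_cochain Q' = to_cochain (Q - Q')"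
  by (cases Q; cases Q') (auto simp: to_cochain_def fun_eq_iff split: list.splits sum.splits)

section \<open>Multilinear maps and cochains in degrees one and two\<close>

lemma all_length_1: "(\<forall>xs. length xs = 1 \<longrightarrow> Q xs) \<longleftrightarrow> (\<forall>x. Q [x])"
  by (auto simp: length_Suc_conv)

lemma all_length_2: "(\<forall>xs. length xs = 2 \<longrightarrow> Q xs) \<longleftrightarrow> (\<forall>x y. Q [x, y])"
  by (auto simp: length_Suc_conv numeral_2_eq_2)

lemma all_length_3: "(\<forall>xs. length xs = 3 \<longrightarrow> Q xs) \<longleftrightarrow> (\<forall>x y z. Q [x, y, z])"
  by (auto simp: length_Suc_conv numeral_3_eq_3)

lemma all_less_2: "(\<forall>i<2. Q i) \<longleftrightarrow> Q 0 \<and> Q (Suc 0)"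
  by (auto simp: less_2_cases_iff)

lemma multilin_1_iff:
  "f \<in> multilin s s' 1 \<longleftrightarrow> module_hom s s' (\<lambda>x. f [x]) \<and> (\<forall>xs. length xs \<noteq> 1 \<longrightarrow> f xs = 0)"
proof -
  have "(\<forall>xs i. length xs = 1 \<longrightarrow> i < 1 \<longrightarrow> module_hom s s' (\<lambda>x. f (xs[i := x]))) \<longleftrightarrow>
    (\<forall>xs. length xs = 1 \<longrightarrow> (\<forall>i<1. module_hom s s' (\<lambda>x. f (xs[i := x]))))" by blast
  then show ?thesis by (simp only: multilin_def all_length_1 mem_Collect_eq) simp
qed

lemma multilin_2_iff:
  "f \<in> multilin s s' 2 \<longleftrightarrow>
     bilin s s s' (\<lambda>x y. f [x, y]) \<and> (\<forall>xs. length xs \<noteq> 2 \<longrightarrow> f xs = 0)"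
proof -
  have "(\<forall>xs i. length xs = 2 \<longrightarrow> i < 2 \<longrightarrow> module_hom s s' (\<lambda>x. f (xs[i := x]))) \<longleftrightarrow>
    (\<forall>xs. length xs = 2 \<longrightarrow> (\<forall>i<2. module_hom s s' (\<lambda>x. f (xs[i := x]))))" by blast
  then show ?thesis
    by (simp only: multilin_def all_length_2 all_less_2 mem_Collect_eq) (auto simp: bilin_def)
qed

lemma mixed_simps: "\<not> mixed []" "\<not> mixed [u]"
  "mixed [Inl a, Inr x]" "mixed [Inr x, Inl a]" "\<not> mixed [Inl a, Inl b]" "\<not> mixed [Inr x, Inr y]"
  by (auto simp: mixed_def)

lemma not_mixed_length_1: "length us = 1 \<Longrightarrow> \<not> mixed us"
  by (auto simp: length_Suc_conv mixed_simps)

text \<open>A list of length one is never mixed. The module hypotheses make the zero map a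
  homomorphism, which the reverse direction requires.\<close>

lemma mixed_multilin_1_iff:
  assumes "module s" "module s'"
  shows "h \<in> mixed_multilin s s' 1 \<longleftrightarrow> h = 0"
  using assms
  by (auto simp: mixed_multilin_def module_hom_iff module.scale_zero_right fun_eq_iff
      not_mixed_length_1[simplified])

lemma mixed_multilin_2_iff:
  "h \<in> mixed_multilin s s' 2 \<longleftrightarrow>
     bilin s s' s' (\<lambda>a x. h [Inl a, Inr x]) \<and> bilin s' s s' (\<lambda>x a. h [Inr x, Inl a]) \<and>
     (\<forall>us. \<not> (length us = 2 \<and> mixed us) \<longrightarrow> h us = 0)" (is "?L \<longleftrightarrow> ?l \<and> ?r \<and> ?z")
proof -
  let ?H = "\<lambda>us i. module_hom s s' (\<lambda>a. h (us[i := Inl a])) \<and> module_hom s' s' (\<lambda>x. h (us[i := Inr x]))"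
  have "?L \<longleftrightarrow> (\<forall>us. length us = 2 \<longrightarrow> (\<forall>i<2. ?H us i)) \<and> ?z"
    unfolding mixed_multilin_def by blast
  moreover have "(\<forall>us. length us = 2 \<longrightarrow> (\<forall>i<2. ?H us i)) \<longleftrightarrow> ?l \<and> ?r" if z: ?z
  proof -
    have 0: "h [Inl a, Inl b] = 0" "h [Inr x, Inr y] = 0" for a b x y
      using z by (simp_all add: mixed_simps)
    \<comment> \<open>Replacing an entry can produce a list with both entries in A or both in B;
      there \<open>h\<close> is zero, and the condition reduces to linearity of the zero
      map.\<close>
    have "module_hom s s' (\<lambda>_. 0)" "module_hom s' s' (\<lambda>_. 0)" if ?l
      using that by (auto simp: bilin_iff module_hom_iff module.scale_zero_right)
    then show ?thesis
      by (auto simp: all_length_2 all_less_2 split_sum_all bilin_def 0)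
  qed
  ultimately show ?thesis by blast
qed

lemma mixed_length_2:
  assumes "length us = 2" "mixed us"
  obtains a x where "us = [Inl a, Inr x]" | a x where "us = [Inr x, Inl a]"
proof -
  from assms(1) obtain u v where "us = [u, v]" by (auto simp: length_Suc_conv numeral_2_eq_2)
  with assms(2) that show thesis by (cases u; cases v) (auto simp: mixed_simps)
qed

text \<open>A 2-cochain vanishes off the right lengths, the mixed lists and the one tree of
  \<open>trees 1\<close>, so it is recovered from its values there by
  \<open>of_cochain\<close>.\<close>

lemma cochains_2: "cochains S 2 = to_cochain ` linear_quintuples S"
proof (intro set_eqI iffI)
  fix c
  assume c: "c \<in> cochains S 2"
  obtain f g h \<gamma> where fgh: "c = (f, g, h, \<gamma>)" by (metis prod.collapse)
  with c have f: "f \<in> multilin (scA S) (scA S) 2" and g: "g \<in> multilin (scB S) (scB S) 2"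
    and h: "h \<in> mixed_multilin (scA S) (scB S) 2" and \<gamma>: "\<gamma> \<in> tree_cochains S 1"
    by (auto simp: cochains_def)
  note lin = f[unfolded multilin_2_iff] g[unfolded multilin_2_iff] h[unfolded mixed_multilin_2_iff]
  have \<gamma>': "\<gamma> (Node [Leaf, Leaf]) \<in> multilin (scB S) (scA S) 1"
    "\<And>T. T \<noteq> Node [Leaf, Leaf] \<Longrightarrow> \<gamma> T = 0"
    using \<gamma> by (simp_all add: tree_cochains_def trees_1[simplified])
  have "of_cochain c \<in> linear_quintuples S"
    using lin \<gamma>'(1) by (simp add: of_cochain_def fgh linear_quintuples_def multilin_1_iff[simplified])
  moreover have "to_cochain (of_cochain c) = c"
  proof -
    have "(if length as = 2 then f [as ! 0, as ! 1] else 0) = f as" for as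
      using lin(1) by (auto simp: length_Suc_conv numeral_2_eq_2)
    moreover have "(if length as = 2 then g [as ! 0, as ! 1] else 0) = g as" for as
      using lin(2) by (auto simp: length_Suc_conv numeral_2_eq_2)
    moreover have "(case us of [Inl a, Inr x] \<Rightarrow> h [Inl a, Inr x]
      | [Inr x, Inl a] \<Rightarrow> h [Inr x, Inl a] | _ \<Rightarrow> 0) = h us" for us
    proof (cases "length us = 2 \<and> mixed us")
      case True
      then show ?thesis by (auto elim: mixed_length_2)
    next
      case False
      with lin(3) have "h us = 0" by blast
      with False show ?thesis by (auto split: list.split sum.split)
    qed
    moreover have "(if T = Node [Leaf, Leaf] \<and> length xs = 1 then \<gamma> (Node [Leaf, Leaf]) [xs ! 0] else 0)
        = \<gamma> T xs" for T xs
      using \<gamma>' by (cases "T = Node [Leaf, Leaf]") (auto simp: multilin_1_iff[simplified] length_Suc_conv)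
    ultimately show ?thesis
      by (simp add: fgh to_cochain_def of_cochain_def fun_eq_iff)
  qed
  ultimately show "c \<in> to_cochain ` linear_quintuples S" by force
next
  fix c
  assume "c \<in> to_cochain ` linear_quintuples S"
  then obtain m n l r p where c: "c = to_cochain (m, n, l, r, p)"
    and lin: "(m, n, l, r, p) \<in> linear_quintuples S" by (auto simp: linear_quintuples_def)
  then have "module_hom (scB S) (scA S) p" by (simp add: linear_quintuples_def)
  moreover have "(case us of [Inl a, Inr x] \<Rightarrow> l a x | [Inr x, Inl a] \<Rightarrow> r x a | _ \<Rightarrow> 0) = 0"
    if "\<not> (length us = 2 \<and> mixed us)" for us
    using that by (auto split: list.split sum.split simp: mixed_simps)
  ultimately show "c \<in> cochains S 2"
    using lin
    by (auto simp: c to_cochain_def cochains_def linear_quintuples_def multilin_2_iff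
        mixed_multilin_2_iff tree_cochains_def trees_1[simplified] multilin_1_iff[simplified])
qed

section \<open>The coboundary in degrees one and two\<close>

lemma marked_simps: "marked [s, t] = {leaves s}" "marked [s, t, u] = {leaves s, leaves s + leaves t}"
proof -
  have m: "marked ts = (\<lambda>q. sum_list (map leaves (take q ts))) ` {1..<length ts}" for ts
    by (auto simp: marked_def)
  have "{Suc 0..<2} = {1}" "{Suc 0..<3} = {1, 2}" by auto
  then show "marked [s, t] = {leaves s}" "marked [s, t, u] = {leaves s, leaves s + leaves t}"
    by (simp_all add: m numeral_2_eq_2[symmetric] numeral_3_eq_3[symmetric])
qed

context rel_avg
begin

text \<open>The function \<open>t\<close> is the last component of the coboundary for
  \<open>n = 2\<close>; \<open>sign (Suc 0)\<close> is the factor \<open>(-1)^(n-1)\<close>. Each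
  tree yields left side minus right side of one averaging equation.\<close>

lemma tree_component:
  assumes Q: "Q = (\<mu>1, \<nu>1, l1, r1, P1)" "Q \<in> linear_quintuples S"
    and c: "to_cochain Q = (f, g, h, \<gamma>)"
  defines "t \<equiv> \<lambda>T xs. sign (Suc 0) (d_P lam S (Suc 0) \<gamma> T xs) + theta lam S 2 f g h T xs"
    and "M \<equiv> \<lambda>x y. mul S (P1 x) (opr S y) + mul S (opr S x) (P1 y) + \<mu>1 (opr S x) (opr S y)"
  shows "t tree_vdash [x, y] =
      M x y - (P1 (lac S (opr S x) y) + opr S (lac S (P1 x) y) + opr S (l1 (opr S x) y))"
    and "t tree_dashv [x, y] =
      M x y - (P1 (rac S x (opr S y)) + opr S (rac S x (P1 y)) + opr S (r1 x (opr S y)))"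
    and "t tree_perp [x, y] =
      M x y - (scA S lam (P1 (nul S x y)) + scA S lam (opr S (\<nu>1 x y)))"
proof -
  have lin: "bilin (scA S) (scA S) (scA S) \<mu>1" "bilin (scB S) (scB S) (scB S) \<nu>1"
    "bilin (scA S) (scB S) (scB S) l1" "bilin (scB S) (scA S) (scB S) r1"
    "module_hom (scB S) (scA S) P1"
    using Q by (auto simp: linear_quintuples_def)
  have T: "tree_dashv \<in> trees 2" "tree_vdash \<in> trees 2" "tree_perp \<in> trees 2"
    by (simp_all add: trees_2)
  have ne: "tree_dashv \<noteq> tree_vdash" "tree_perp \<noteq> tree_vdash" "tree_dashv \<noteq> tree_perp"
    "tree_vdash \<noteq> tree_dashv" "tree_vdash \<noteq> tree_perp" "tree_perp \<noteq> tree_dashv"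
    by (simp_all add: tree_dashv_def tree_vdash_def tree_perp_def)
  have \<gamma>: "\<gamma> (Node [Leaf, Leaf]) [z] = P1 z" for z
    using c by (auto simp: to_cochain_def Q)
  note simps = d_P_def tree_d_def P_bracket_def sign_def theta_def \<gamma>
    bracket_2_1[OF T(1)] bracket_2_1[OF T(2)] bracket_2_1[OF T(3)] zero_ext_def
    pi_cochain_def ne R_inner_simps del_leaf_trees_2[OF T(1)] del_leaf_trees_2[OF T(2)]
    del_leaf_trees_2[OF T(3)] total_to_cochain[OF c] mult1_def Q
    bilin_simps[OF lin(1)] bilin_simps[OF lin(2)] bilin_simps[OF lin(3)] bilin_simps[OF lin(4)]
    module_hom.zero[OF lin(5)] module_hom.scale[OF lin(5)] simps_S zero_prod_def
  have upt: "[Suc 0..<3] = [Suc 0, 2]"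
    by (simp add: upt_rec)
  \<comment> \<open>\<open>tree_d\<close> contributes only on \<open>tree_perp\<close>, where
    \<open>pi_cochain\<close> sees the product of B. The action terms on the other two trees, and
    the products in A on all three, come from the double bracket.\<close>
  have d: "d_P lam S (Suc 0) \<gamma> tree_vdash [x, y] =
      P1 (lac S (opr S x) y) + opr S (lac S (P1 x) y) - mul S (P1 x) (opr S y) - mul S (opr S x) (P1 y)"
    "d_P lam S (Suc 0) \<gamma> tree_dashv [x, y] =
      P1 (rac S x (opr S y)) + opr S (rac S x (P1 y)) - mul S (P1 x) (opr S y) - mul S (opr S x) (P1 y)"
    "d_P lam S (Suc 0) \<gamma> tree_perp [x, y] =
      scA S lam (P1 (nul S x y)) - mul S (P1 x) (opr S y) - mul S (opr S x) (P1 y)"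
    by (simp_all add: simps)
  have f: "f [a, b] = \<mu>1 a b" for a b
    using c by (auto simp: to_cochain_def Q)
  \<comment> \<open>The marked sets are \<open>{2}\<close>, \<open>{1}\<close> and
    \<open>{1, 2}\<close>; a marked argument stays in B, which selects \<open>l1\<close>,
    \<open>r1\<close> and \<open>\<nu>1\<close>. The power of \<open>lam\<close> is 0 for the binary
    roots and 1 for the ternary one.\<close>
  have th: "theta lam S 2 f g h tree_vdash [x, y] = \<mu>1 (opr S x) (opr S y) - opr S (l1 (opr S x) y)"
    "theta lam S 2 f g h tree_dashv [x, y] = \<mu>1 (opr S x) (opr S y) - opr S (r1 x (opr S y))"
    "theta lam S 2 f g h tree_perp [x, y] = \<mu>1 (opr S x) (opr S y) - scA S lam (opr S (\<nu>1 x y))"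
    by (simp_all add: simps f tree_vdash_def tree_dashv_def tree_perp_def marked_simps upt)
  show "t tree_vdash [x, y] =
      M x y - (P1 (lac S (opr S x) y) + opr S (lac S (P1 x) y) + opr S (l1 (opr S x) y))"
    "t tree_dashv [x, y] =
      M x y - (P1 (rac S x (opr S y)) + opr S (rac S x (P1 y)) + opr S (r1 x (opr S y)))"
    "t tree_perp [x, y] =
      M x y - (scA S lam (P1 (nul S x y)) + scA S lam (opr S (\<nu>1 x y)))"
    by (simp_all add: t_def M_def d th sign_def algebra_simps)
qed

lemma coboundary_2_eq_0_iff:
  assumes "Q \<in> linear_quintuples S"
  shows "coboundary lam S 2 (to_cochain Q) = 0 \<longleftrightarrow>
    bimodule_equations S Q \<and> averaging_equations lam S Q"
proof -
  obtain \<mu>1 \<nu>1 l1 r1 P1 where Q: "Q = (\<mu>1, \<nu>1, l1, r1, P1)" by (cases Q) auto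
  obtain f g h \<gamma> where c: "to_cochain Q = (f, g, h, \<gamma>)" by (metis prod.collapse)
  have lin: "bilin (scA S) (scA S) (scA S) \<mu>1" "bilin (scB S) (scB S) (scB S) \<nu>1"
    "bilin (scA S) (scB S) (scB S) l1" "bilin (scB S) (scA S) (scB S) r1"
    using assms Q by (auto simp: linear_quintuples_def)
  define dF where "dF = hochschild (semidirect_mult S) 2 (total f g h)"
  have dF: "dF [u, v, w] = semidirect_mult S u (mult1 Q v w) - mult1 Q (semidirect_mult S u v) w
      + mult1 Q u (semidirect_mult S v w) - semidirect_mult S (mult1 Q u v) w" for u v w
    by (simp add: dF_def hochschild_2 total_to_cochain[OF c])
  define t where "t = (\<lambda>T xs. sign (Suc 0) (d_P lam S (Suc 0) \<gamma> T xs) + theta lam S 2 f g h T xs)"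
  have "coboundary lam S 2 (to_cochain Q) = 0 \<longleftrightarrow>
      (\<forall>as. length as = 3 \<longrightarrow> fst (dF (map (\<lambda>a. (a, 0)) as)) = 0) \<and>
      (\<forall>xs. length xs = 3 \<longrightarrow> snd (dF (map (Pair 0) xs)) = 0) \<and>
      (\<forall>us. length us = 3 \<longrightarrow> mixed us \<longrightarrow> snd (dF (map incl us)) = 0) \<and>
      (\<forall>xs. length xs = 2 \<longrightarrow> (\<forall>T\<in>trees 2. t T xs = 0))"
    by (auto simp: coboundary_def c dF_def[symmetric] t_def zero_prod_def fun_eq_iff)
  also have "\<dots> \<longleftrightarrow> bimodule_equations S Q \<and> averaging_equations lam S Q"
  proof -
    \<comment> \<open>Splitting the arguments by summand turns the mixed component into six
      equations; the components on A and on B supply the other two.\<close>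
    have "(\<forall>as. length as = 3 \<longrightarrow> fst (dF (map (\<lambda>a. (a, 0)) as)) = 0) \<and>
      (\<forall>xs. length xs = 3 \<longrightarrow> snd (dF (map (Pair 0) xs)) = 0) \<and>
      (\<forall>us. length us = 3 \<longrightarrow> mixed us \<longrightarrow> snd (dF (map incl us)) = 0) \<longleftrightarrow>
      bimodule_equations S Q"
      by (simp add: all_length_3 split_sum_all mixed_def ex_disj_distrib dF mult1_def Q
          semidirect_mult_def bimodule_equations_def simps_S bilin_simps[OF lin(1)]
          bilin_simps[OF lin(2)] bilin_simps[OF lin(3)] bilin_simps[OF lin(4)] all_conj_distrib)
        (intro iffI conjI allI; elim conjE; simp only:)
    moreover have "(\<forall>xs. length xs = 2 \<longrightarrow> (\<forall>T\<in>trees 2. t T xs = 0)) \<longleftrightarrow>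
      averaging_equations lam S Q"
      unfolding all_length_2 trees_2 ball_simps
      using tree_component[OF Q assms c]
      by (auto simp: averaging_equations_def Q t_def Let_def)
    ultimately show ?thesis by blast
  qed
  finally show ?thesis .
qed


text \<open>The coboundary of \<open>(\<phi>, \<psi>)\<close> as a quintuple: four parts of the
  Hochschild coboundary of \<open>\<phi> + \<psi>\<close>, and \<open>theta\<close> in degree one,
  whose sign \<open>(-1)^1\<close> puts \<open>\<phi>\<close> of \<open>opr S x\<close>
  last.\<close>

definition first_order_change :: "('a \<Rightarrow> 'a) \<Rightarrow> ('b \<Rightarrow> 'b) \<Rightarrow> ('a, 'b) quintuple" where
  "first_order_change \<phi> \<psi> =
     (\<lambda>a b. mul S a (\<phi> b) - \<phi> (mul S a b) + mul S (\<phi> a) b,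
      \<lambda>x y. nul S x (\<psi> y) - \<psi> (nul S x y) + nul S (\<psi> x) y,
      \<lambda>a x. lac S a (\<psi> x) - \<psi> (lac S a x) + lac S (\<phi> a) x,
      \<lambda>x a. rac S x (\<phi> a) - \<psi> (rac S x a) + rac S (\<psi> x) a,
      \<lambda>x. opr S (\<psi> x) - \<phi> (opr S x))"

lemma coboundary_1:
  assumes f: "module_hom (scA S) (scA S) (\<lambda>a. f [a])"
    and g: "module_hom (scB S) (scB S) (\<lambda>x. g [x])"
  shows "coboundary lam S 1 (f, g, 0, 0) =
    to_cochain (first_order_change (\<lambda>a. f [a]) (\<lambda>x. g [x]))"
proof -
  note zero = module_hom.zero[OF f] module_hom.zero[OF g]
  define dF where "dF = hochschild (semidirect_mult S) 1 (total f g 0)"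
  have dF: "dF [u, v] = semidirect_mult S u (f [fst v], g [snd v])
      - (f [fst (semidirect_mult S u v)], g [snd (semidirect_mult S u v)])
      + semidirect_mult S (f [fst u], g [snd u]) v" for u v
    unfolding dF_def hochschild_1 total_single ..
  note dF_simps = dF semidirect_mult_def simps_S zero first_order_change_def
  have "(if length as = 2 then fst (dF (map (\<lambda>a. (a, 0)) as)) else 0) =
      fst (to_cochain (first_order_change (\<lambda>a. f [a]) (\<lambda>x. g [x]))) as" for as
    by (auto simp: to_cochain_def dF_simps numeral_2_eq_2 length_Suc_conv)
  moreover have "(if length xs = 2 then snd (dF (map (Pair 0) xs)) else 0) =
      fst (snd (to_cochain (first_order_change (\<lambda>a. f [a]) (\<lambda>x. g [x])))) xs" for xs
    by (auto simp: to_cochain_def dF_simps numeral_2_eq_2 length_Suc_conv)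
  moreover have "(if length us = 2 \<and> mixed us then snd (dF (map incl us)) else 0) =
      fst (snd (snd (to_cochain (first_order_change (\<lambda>a. f [a]) (\<lambda>x. g [x]))))) us" for us
  proof (cases "length us = 2 \<and> mixed us")
    case True
    then show ?thesis
      by (auto elim!: mixed_length_2 simp: to_cochain_def dF_simps mixed_simps)
  next
    case False
    then show ?thesis
      by (auto split: list.split sum.split simp: to_cochain_def first_order_change_def mixed_simps)
  qed
  \<comment> \<open>\<open>d_P\<close> is zero in degree 0, so only \<open>theta\<close> remains. On
    the two-leaf tree the sole argument is marked and enters as an element of B.\<close>
  moreover have "(if T \<in> trees 1 \<and> length xs = 1
      then sign (1 - 1) (d_P lam S (1 - 1) 0 T xs) + theta lam S 1 f g 0 T xs else 0) =
      snd (snd (snd (to_cochain (first_order_change (\<lambda>a. f [a]) (\<lambda>x. g [x]))))) T xs" for T xs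
    by (auto simp: to_cochain_def first_order_change_def trees_1[simplified] d_P_def theta_def
        sign_def marked_simps total_single length_Suc_conv simps_S)
  ultimately show ?thesis
    unfolding coboundary_def prod.case Let_def dF_def[symmetric]
    by (intro prod_eqI ext) (simp_all add: numeral_2_eq_2)
qed

lemma coboundaries_2:
  "coboundaries lam S 2 = {to_cochain (first_order_change \<phi> \<psi>) | \<phi> \<psi>.
     module_hom (scA S) (scA S) \<phi> \<and> module_hom (scB S) (scB S) \<psi>}"
proof (intro set_eqI iffI)
  fix c
  assume "c \<in> coboundaries lam S 2"
  then obtain f g h \<gamma> where c: "c = coboundary lam S 1 (f, g, h, \<gamma>)"
    and "(f, g, h, \<gamma>) \<in> cochains S 1" by (auto simp: coboundaries_def)
  then have "f \<in> multilin (scA S) (scA S) 1" "g \<in> multilin (scB S) (scB S) 1" "h = 0" "\<gamma> = 0"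
    using mixed_multilin_1_iff[OF module_A module_B] by (auto simp: cochains_def tree_cochains_def)
  then show "c \<in> {to_cochain (first_order_change \<phi> \<psi>) | \<phi> \<psi>.
     module_hom (scA S) (scA S) \<phi> \<and> module_hom (scB S) (scB S) \<psi>}"
    using coboundary_1[of f g] by (auto simp: c multilin_1_iff[simplified])
next
  fix c
  assume "c \<in> {to_cochain (first_order_change \<phi> \<psi>) | \<phi> \<psi>.
     module_hom (scA S) (scA S) \<phi> \<and> module_hom (scB S) (scB S) \<psi>}"
  then obtain \<phi> \<psi> where c: "c = to_cochain (first_order_change \<phi> \<psi>)"
    and hom: "module_hom (scA S) (scA S) \<phi>" "module_hom (scB S) (scB S) \<psi>" by blast
  define f where "f = (\<lambda>as. if length as = 1 then \<phi> (as ! 0) else 0)"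
  define g where "g = (\<lambda>xs. if length xs = 1 then \<psi> (xs ! 0) else 0)"
  have fg: "(\<lambda>a. f [a]) = \<phi>" "(\<lambda>x. g [x]) = \<psi>" by (auto simp: f_def g_def)
  then have "c = coboundary lam S 1 (f, g, 0, 0)"
    using coboundary_1[of f g] hom c by simp
  moreover have "(f, g, 0, 0) \<in> cochains S 1"
  proof -
    have "f \<in> multilin (scA S) (scA S) 1" "g \<in> multilin (scB S) (scB S) 1"
      unfolding multilin_1_iff fg using hom by (auto simp: f_def g_def)
    then show ?thesis
      using mixed_multilin_1_iff[OF module_A module_B] by (simp add: cochains_def tree_cochains_def)
  qed
  ultimately show "c \<in> coboundaries lam S 2" by (simp add: coboundaries_def)
qed

end

section \<open>Equivalence of deformations as a coboundary condition\<close>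

text \<open>The constant coefficients agree since both sides deform the same \<open>p\<close>, and
  the terms with t-parts of the arguments cancel by additivity. Three separate maps
  \<open>\<chi>\<close>, \<open>\<phi>\<close>, \<open>\<psi>\<close> let one statement cover both
  products and both actions.\<close>

lemma ext2_hom_iff:
  assumes "bilin k1 k2 k3 p"
  shows "(\<forall>u v. ext1 id \<chi> (ext2 p p1 u v) = ext2 p p1' (ext1 id \<phi> u) (ext1 id \<psi> v)) \<longleftrightarrow>
    (\<forall>a b. p1 a b - p1' a b = p a (\<psi> b) - \<chi> (p a b) + p (\<phi> a) b)"
proof -
  have "(ext1 id \<chi> (ext2 p p1 u v) = ext2 p p1' (ext1 id \<phi> u) (ext1 id \<psi> v)) \<longleftrightarrow>
    p1 (coeff0 u) (coeff0 v) - p1' (coeff0 u) (coeff0 v) =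
      p (coeff0 u) (\<psi> (coeff0 v)) - \<chi> (p (coeff0 u) (coeff0 v)) + p (\<phi> (coeff0 u)) (coeff0 v)"
    for u v
    by (auto simp: ext1_def ext2_def bilin_simps[OF assms] algebra_simps)
  \<comment> \<open>Only constant coefficients occur, and every element is the constant coefficient
    of some truncated series.\<close>
  then show ?thesis by (metis trunc.sel(1))
qed

context rel_avg
begin

text \<open>Each morphism condition reduces to its t-coefficient. The morphism runs from
  \<open>Q\<close> to \<open>Q'\<close>, which fixes the sign of the difference.\<close>

lemma deformation_equiv_iff:
  assumes "Q \<in> inf_deformations lam S" "Q' \<in> inf_deformations lam S"
  shows "(Q, Q') \<in> deformation_equiv lam S \<longleftrightarrow>
    (\<exists>\<phi> \<psi>. module_hom (scA S) (scA S) \<phi> \<and> module_hom (scB S) (scB S) \<psi> \<and>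
       Q - Q' = first_order_change \<phi> \<psi>)"
proof -
  obtain m n l r p m' n' l' r' p' where Q: "Q = (m, n, l, r, p)" "Q' = (m', n', l', r', p')"
    by (metis prod.collapse)
  have "rel_avg_morphism (deformed S Q) (deformed S Q') (ext1 id \<phi>) (ext1 id \<psi>) \<longleftrightarrow>
      Q - Q' = first_order_change \<phi> \<psi>"
    if hom: "module_hom (scA S) (scA S) \<phi>" "module_hom (scB S) (scB S) \<psi>" for \<phi> \<psi>
  proof -
    have "module_hom (scA S) (scA S) id" "module_hom (scB S) (scB S) id"
      by (simp_all add: module_hom_iff module_A module_B)
    note ext_hom = this[THEN module_hom_ext1] hom
    have "(\<forall>u. ext1 id \<phi> (ext1 (opr S) p u) = ext1 (opr S) p' (ext1 id \<psi> u)) \<longleftrightarrow>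
        (\<forall>x. p x - p' x = opr S (\<psi> x) - \<phi> (opr S x))"
    proof -
      have "ext1 id \<phi> (ext1 (opr S) p u) = ext1 (opr S) p' (ext1 id \<psi> u) \<longleftrightarrow>
        p (coeff0 u) - p' (coeff0 u) = opr S (\<psi> (coeff0 u)) - \<phi> (opr S (coeff0 u))" for u
        by (auto simp: ext1_def simps_S algebra_simps)
      then show ?thesis by (metis trunc.sel(1))
    qed
    \<comment> \<open>Treated separately because the morphism axiom for the right action quantifies
      over the A-argument first, while \<open>rac\<close> takes it second.\<close>
    moreover have "(\<forall>u v. ext1 id \<psi> (ext2 (rac S) r v u) =
        ext2 (rac S) r' (ext1 id \<psi> v) (ext1 id \<phi> u)) \<longleftrightarrow>
        (\<forall>x a. r x a - r' x a = rac S x (\<phi> a) - \<psi> (rac S x a) + rac S (\<psi> x) a)"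
      using ext2_hom_iff[OF bilin_structure(4), of \<psi> r r' \<psi> \<phi>] by blast
    ultimately show ?thesis
      by (simp add: rel_avg_morphism_def deformed_def Q first_order_change_def fun_eq_iff
          ext_hom ext2_hom_iff[OF bilin_structure(1)] ext2_hom_iff[OF bilin_structure(2)]
          ext2_hom_iff[OF bilin_structure(3)])
  qed
  with assms show ?thesis unfolding deformation_equiv_def by blast
qed

section \<open>From deformations and cocycles to their classes\<close>

text \<open>Both sides are cut out of \<open>linear_quintuples S\<close> by the same equations, and
  \<open>of_cochain\<close> gives injectivity.\<close>

lemma bij_betw_to_cochain:
  "bij_betw to_cochain (inf_deformations lam S) (cocycles lam S 2)"
proof -
  have "cocycles lam S 2 = to_cochain ` inf_deformations lam S"
    using inf_deformations_iff coboundary_2_eq_0_iff by (auto simp: cocycles_def cochains_2)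
  then show ?thesis by (metis bij_betw_def inj_on_inverseI of_to_cochain)
qed

lemma to_cochain_equiv_iff:
  assumes "Q \<in> inf_deformations lam S" "Q' \<in> inf_deformations lam S"
  shows "(Q, Q') \<in> deformation_equiv lam S \<longleftrightarrow>
    to_cochain Q - to_cochain Q' \<in> coboundaries lam S 2"
proof -
  have "to_cochain Q - to_cochain Q' = to_cochain R \<longleftrightarrow> Q - Q' = R" for R
    unfolding to_cochain_diff by (metis of_to_cochain)
  then show ?thesis
    unfolding deformation_equiv_iff[OF assms] coboundaries_2 by blast
qed

end

text \<open>The map \<open>f\<close> carries the class of \<open>x\<close> onto the class of
  \<open>f x\<close>; distinct classes stay distinct because \<open>f\<close> is injective on
  \<open>X\<close> and classes are subsets of \<open>X\<close>.\<close>

lemma bij_betw_quotient: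
  assumes f: "bij_betw f X Y" and R: "R \<subseteq> X \<times> X" and R': "R' \<subseteq> Y \<times> Y"
    and iff: "\<And>x x'. x \<in> X \<Longrightarrow> x' \<in> X \<Longrightarrow> (x, x') \<in> R \<longleftrightarrow> (f x, f x') \<in> R'"
  shows "bij_betw ((`) f) (X // R) (Y // R')"
proof (rule bij_betw_imageI)
  have "X // R \<subseteq> Pow X"
    using R by (auto simp: quotient_def)
  moreover have "inj_on ((`) f) (Pow X)"
    using f by (simp add: bij_betw_def inj_on_image_Pow)
  ultimately show "inj_on ((`) f) (X // R)"
    by (rule inj_on_subset[rotated])
  have "f ` (R `` {x}) = R' `` {f x}" if x: "x \<in> X" for x
  proof (intro equalityI subsetI)
    fix y
    assume "y \<in> f ` (R `` {x})"
    then obtain x' where "y = f x'" "(x, x') \<in> R" by blast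
    with R iff x show "y \<in> R' `` {f x}" by blast
  next
    fix y
    assume y: "y \<in> R' `` {f x}"
    then obtain x' where "x' \<in> X" "y = f x'"
      using R' bij_betw_imp_surj_on[OF f] by blast
    with y iff[of x x'] x show "y \<in> f ` (R `` {x})" by blast
  qed
  then show "(`) f ` (X // R) = Y // R'"
    unfolding quotient_def bij_betw_imp_surj_on[OF f, symmetric] by auto
qed

theorem theorem7p3:
  fixes lam :: "'k::field_char_0"
    and S :: "('k, 'a::ab_group_add, 'b::ab_group_add) avg_data"
  assumes "lam \<noteq> 0"
    and "rel_avg_algebra lam S"
  shows "\<exists>\<Phi>. bij_betw \<Phi> (inf_deformations lam S // deformation_equiv lam S) (cohomology lam S 2)"
proof -
  interpret rel_avg lam S
    by unfold_locales (rule assms(2))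
  \<comment> \<open>The bijection sends a class of deformations to the set of associated
    cocycles.\<close>
  have "bij_betw ((`) to_cochain) (inf_deformations lam S // deformation_equiv lam S)
      (cohomology lam S 2)"
    unfolding cohomology_def
  proof (rule bij_betw_quotient[OF bij_betw_to_cochain])
    show "deformation_equiv lam S \<subseteq> inf_deformations lam S \<times> inf_deformations lam S"
      by (auto simp: deformation_equiv_def)
  next
    fix Q Q'
    assume "Q \<in> inf_deformations lam S" "Q' \<in> inf_deformations lam S"
    then show "(Q, Q') \<in> deformation_equiv lam S \<longleftrightarrow> (to_cochain Q, to_cochain Q') \<in>
      {(c, c'). c \<in> cocycles lam S 2 \<and> c' \<in> cocycles lam S 2 \<and> c - c' \<in> coboundaries lam S 2}"
      using to_cochain_equiv_iff bij_betwE[OF bij_betw_to_cochain] by simp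
  qed auto
  then show ?thesis by blast
qed

end
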